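(* For any $w, w'\in\widehat{\mathfrak{H}}^{0}$ we have $Z_{q}(w*w')=Z_{q}(w)\,Z_{q}(w')$, where $*$ is the harmonic product.
   Context: Fix a complex number $q$ with $0<|q|<1$ and set $[n]:=\frac{1-q^{n}}{1-q}$ for $n\ge 1$. Let $\hbar$ be a formal variable, $\mathcal{C}:=\mathbb{Q}[\hbar]$, and let $\mathfrak{H}$ be the non-commutative polynomial algebra over $\mathcal{C}$ freely generated by $x,y,\rho$. Set $\xi:=y-\rho$ and $z_{k}:=x^{k-1}y$ $(k\ge1)$. Let $\mathfrak{H}^{1}$ be the subalgebra of $\mathfrak{H}$ (freely) generated by the set $A:=\{\xi\}\cup\{z_{k}\}_{k\ge1}$, and let $\widehat{\mathfrak{H}}^{0}:=\mathcal{C}+\xi\mathfrak{H}^{1}+\sum_{k\ge2}z_{k}\mathfrak{H}^{1}$, a $\mathcal{C}$-submodule of $\mathfrak{H}^1$. $\mathbb{C}$ is regarded as a $\mathcal{C}$-module with $\hbar$ acting as multiplication by $1-q$. Let $\mathfrak{z}$ be the $\mathcal{C}$-submodule of $\mathfrak{H}$ generated by $A$. For $n\ge1$ let $u\mapsto I_{u}(n)$ be the $\mathcal{C}$-linear map $\mathfrak{z}\to\mathbb{C}$ with $I_{\xi}(n)=\frac{q^{n}}{[n]}$ and $I_{z_{k}}(n)=\frac{q^{(k-1)n}}{[n]^{k}}$. The $\mathcal{C}$-linear map $Z_{q}:\widehat{\mathfrak{H}}^{0}\to\mathbb{C}$ is defined by $Z_{q}(1)=1$ and, for a word $u_{1}\cdots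 u_{r}\in\widehat{\mathfrak{H}}^{0}$ with $r\ge1$, $u_{i}\in A$, by the absolutely convergent sum $Z_{q}(u_{1}\cdots u_{r})=\sum_{n_{1}>\cdots>n_{r}>0}\prod_{i=1}^{r}I_{u_{i}}(n_{i})$. Harmonic product: let $\circ$ be the commutative $\mathcal{C}$-bilinear product on $\mathfrak{z}$ with $z_{k}\circ z_{l}=z_{k+l}+\hbar z_{k+l-1}$, $\xi\circ z_{k}=z_{k+1}$, $\xi\circ\xi=z_{2}-\hbar\xi$ for $k,l\ge1$. The $\mathcal{C}$-bilinear product $*$ on $\mathfrak{H}^{1}$ is defined inductively by $1*w=w*1=w$ and $(u_{1}w)*(u_{2}w')=u_{1}(w*u_{2}w')+u_{2}(u_{1}w*w')+(u_{1}\circ u_{2})(w*w')$ for $w,w'\in\mathfrak{H}^{1}$, $u_{1},u_{2}\in A$. The submodule $\widehat{\mathfrak{H}}^{0}$ is closed under $*$. *)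

theory Defs
  imports "HOL-Analysis.Analysis" "HOL-Library.Poly_Mapping"
    "HOL-Computational_Algebra.Polynomial"
begin

section \<open>Free algebras over \<open>\<rat>[\<hbar>]\<close>\<close>

text \<open>Lists form a monoid under concatenation, so the convolution product of
  \<open>Poly_Mapping\<close> makes \<open>'a list \<Rightarrow>\<^sub>0 rat poly\<close> the free associative unital algebra
  over \<open>\<rat>[\<hbar>]\<close> on the alphabet \<open>'a\<close>.\<close>

instantiation list :: (type) monoid_add
begin

definition zero_list :: "'a list" where "zero_list = []"
definition plus_list :: "'a list \<Rightarrow> 'a list \<Rightarrow> 'a list" where "plus_list = (@)"

instance
  by standard (simp_all add: zero_list_def plus_list_def)

end

type_synonym 'a free_alg = "'a list \<Rightarrow>\<^sub>0 rat poly"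

definition cst :: "rat poly \<Rightarrow> 'a free_alg" where
  "cst c = Poly_Mapping.single [] c"

definition hbar :: "rat poly" where
  "hbar = [:0, 1:]"

definition lin_ext :: "('a list \<Rightarrow> 'b free_alg) \<Rightarrow> 'a free_alg \<Rightarrow> 'b free_alg" where
  "lin_ext f p = (\<Sum>w\<in>Poly_Mapping.keys p. cst (Poly_Mapping.lookup p w) * f w)"

inductive_set subalg :: "'a free_alg set \<Rightarrow> 'a free_alg set" for S where
  cst: "cst c \<in> subalg S"
| gen: "a \<in> S \<Longrightarrow> a \<in> subalg S"
| add: "a \<in> subalg S \<Longrightarrow> b \<in> subalg S \<Longrightarrow> a + b \<in> subalg S"
| mult: "a \<in> subalg S \<Longrightarrow> b \<in> subalg S \<Longrightarrow> a * b \<in> subalg S"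


section \<open>The algebra \<open>\<HH>\<close> and its subspaces\<close>

datatype gen = X | Y | Rho

type_synonym alg = "gen free_alg"

definition xx :: alg where "xx = Poly_Mapping.single [X] 1"
definition yy :: alg where "yy = Poly_Mapping.single [Y] 1"
definition rho :: alg where "rho = Poly_Mapping.single [Rho] 1"

definition xi :: alg where "xi = yy - rho"

text \<open>Only meant for \<open>k \<ge> 1\<close>.\<close>

definition z :: "nat \<Rightarrow> alg" where "z k = xx ^ (k - 1) * yy"

definition AA :: "alg set" where "AA = insert xi (z ` {1..})"

definition H1 :: "alg set" where "H1 = subalg AA"

definition Hhat0 :: "alg set" where
  "Hhat0 = {cst c + xi * a + (\<Sum>k=2..m. z k * b k) | c a b m.
      a \<in> H1 \<and> (\<forall>k. b k \<in> H1)}"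

text \<open>Names for the elements of \<open>AA\<close>. The index is shifted: \<open>Zs j\<close> names \<open>z (j + 1)\<close>,
  so that distinct names stand for distinct elements.\<close>

datatype letter = Xi | Zs nat

fun elt :: "letter \<Rightarrow> alg" where
  "elt Xi = xi"
| "elt (Zs j) = z (j + 1)"

definition word :: "letter list \<Rightarrow> alg" where
  "word us = prod_list (map elt us)"

definition of_coord :: "letter free_alg \<Rightarrow> alg" where
  "of_coord = lin_ext word"

text \<open>Coordinates of an element of \<open>H1\<close> in the basis of words. They are well defined by
  \<open>inj_of_coord\<close> and \<open>range_of_coord\<close> below.\<close>

definition coord :: "alg \<Rightarrow> letter free_alg" where
  "coord = inv of_coord"


section \<open>The harmonic product\<close>

fun circ :: "letter \<Rightarrow> letter \<Rightarrow> alg" where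
  "circ Xi Xi = z 2 - cst hbar * xi"
| "circ Xi (Zs j) = z ((j + 1) + 1)"
| "circ (Zs i) Xi = z ((i + 1) + 1)"
| "circ (Zs i) (Zs j) = z ((i + 1) + (j + 1)) + cst hbar * z ((i + 1) + (j + 1) - 1)"

fun harm_word :: "letter list \<Rightarrow> letter list \<Rightarrow> alg" where
  "harm_word [] w = word w"
| "harm_word (u # w) [] = word (u # w)"
| "harm_word (u # w) (v # w') =
     elt u * harm_word w (v # w') + elt v * harm_word (u # w) w' + circ u v * harm_word w w'"

text \<open>This is the harmonic product of two elements of \<open>H1\<close>; the value is irrelevant outside
  \<open>H1\<close>.\<close>

definition harm :: "alg \<Rightarrow> alg \<Rightarrow> alg" (infixl \<open>\<star>\<close> 70) where
  "a \<star> b = lin_ext (\<lambda>w. lin_ext (\<lambda>w'. harm_word w w') (coord b)) (coord a)"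


section \<open>The map \<open>Z\<^sub>q\<close>\<close>

definition qint :: "complex \<Rightarrow> nat \<Rightarrow> complex" where
  "qint q n = (1 - q ^ n) / (1 - q)"

fun Iq :: "complex \<Rightarrow> letter \<Rightarrow> nat \<Rightarrow> complex" where
  "Iq q Xi n = q ^ n / qint q n"
| "Iq q (Zs j) n = q ^ (((j + 1) - 1) * n) / qint q n ^ (j + 1)"

definition decr_seqs :: "nat \<Rightarrow> nat list set" where
  "decr_seqs r = {ns. length ns = r \<and> sorted_wrt (>) ns \<and> (\<forall>n\<in>set ns. n > 0)}"

definition Zq_word :: "complex \<Rightarrow> letter list \<Rightarrow> complex" where
  "Zq_word q us = (\<Sum>\<^sub>\<infinity>ns\<in>decr_seqs (length us). \<Prod>i<length us. Iq q (us ! i) (ns ! i))"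

text \<open>The action of \<open>\<rat>[\<hbar>]\<close> on \<open>\<complex>\<close> is through the following ring homomorphism.\<close>

definition scal :: "complex \<Rightarrow> rat poly \<Rightarrow> complex" where
  "scal q c = poly (map_poly of_rat c) (1 - q)"

text \<open>Meant for arguments in \<open>Hhat0\<close>, where the sums \<open>Zq_word\<close> that occur converge.\<close>

definition Zq :: "complex \<Rightarrow> alg \<Rightarrow> complex" where
  "Zq q a = (\<Sum>us\<in>Poly_Mapping.keys (coord a).
      scal q (Poly_Mapping.lookup (coord a) us) * Zq_word q us)"


section \<open>Well-definedness\<close>

lemma single_mult_list:
  "Poly_Mapping.single v a * Poly_Mapping.single w b = Poly_Mapping.single (v @ w) (a * b)"
  by (simp add: mult_single plus_list_def)

lemma cst_one [simp]: "cst 1 = 1"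
  by (metis cst_def single_one zero_list_def)

lemma cst_zero [simp]: "cst 0 = 0"
  by (simp add: cst_def)

lemma cst_add: "cst (a + b) = cst a + cst b"
  by (simp add: cst_def single_add)

lemma cst_mult: "cst (a * b) = cst a * cst b"
  by (simp add: cst_def single_mult_list)

lemma lookup_cst_mult [simp]:
  "Poly_Mapping.lookup (cst c * p) w = c * Poly_Mapping.lookup p w"
proof -
  have "cst c * p = Poly_Mapping.map ((*) c) p"
    unfolding cst_def by (metis mult_map_scale_conv_mult zero_list_def)
  then show ?thesis by (simp add: map.rep_eq when_def)
qed

lemma free_alg_eq_sum:
  "p = (\<Sum>w\<in>Poly_Mapping.keys p. Poly_Mapping.single w (Poly_Mapping.lookup p w))"
  by (rule poly_mapping_eqI)
    (simp add: lookup_sum lookup_single when_def in_keys_iff)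

lemma free_alg_induct [case_names zero single add]:
  assumes "P 0" and "\<And>w c. P (Poly_Mapping.single w c)"
    and "\<And>p r. P p \<Longrightarrow> P r \<Longrightarrow> P (p + r)"
  shows "P (p :: 'a free_alg)"
proof -
  have "P (\<Sum>w\<in>K. Poly_Mapping.single w (Poly_Mapping.lookup p w))" if "finite K" for K
    using that by (induction K) (auto intro: assms)
  then show ?thesis by (metis finite_keys free_alg_eq_sum)
qed

lemma cst_commute: "cst c * p = p * cst c"
  by (induction p rule: free_alg_induct)
    (simp_all add: cst_def single_mult_list distrib_left distrib_right mult.commute)

lemma mult_cst_left: "a * (cst c * b) = cst c * (a * b)"
  by (metis cst_commute mult.assoc)

lemma lin_ext_superset:
  assumes "finite K" "Poly_Mapping.keys p \<subseteq> K"
  shows "lin_ext f p = (\<Sum>w\<in>K. cst (Poly_Mapping.lookup p w) * f w)"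
  unfolding lin_ext_def
  by (rule sum.mono_neutral_left) (use assms in \<open>auto simp: in_keys_iff\<close>)

lemma lin_ext_zero [simp]: "lin_ext f 0 = 0"
  by (simp add: lin_ext_def)

lemma lin_ext_add: "lin_ext f (p + r) = lin_ext f p + lin_ext f r"
proof -
  let ?K = "Poly_Mapping.keys p \<union> Poly_Mapping.keys r"
  have "Poly_Mapping.keys (p + r) \<subseteq> ?K" by (rule Poly_Mapping.keys_add)
  then show ?thesis
    by (simp add: lin_ext_superset[of ?K] lookup_add cst_add distrib_right sum.distrib)
qed

lemma lin_ext_scale: "lin_ext f (cst c * p) = cst c * lin_ext f p"
proof -
  have "Poly_Mapping.keys (cst c * p) \<subseteq> Poly_Mapping.keys p"
    by (auto simp: in_keys_iff)
  then show ?thesis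
    by (simp add: lin_ext_superset[of "Poly_Mapping.keys p"] cst_mult sum_distrib_left mult.assoc)
qed

lemma lin_ext_single [simp]: "lin_ext f (Poly_Mapping.single w c) = cst c * f w"
  by (simp add: lin_ext_def)

lemma lin_ext_mult:
  assumes "\<And>v w. f (v @ w) = f v * f w"
  shows "lin_ext f (p * r) = lin_ext f p * lin_ext f r"
proof (induction p rule: free_alg_induct)
  case (single w c)
  show ?case
  proof (induction r rule: free_alg_induct)
    case (single v d)
    show ?case
      by (simp add: single_mult_list assms cst_mult)
        (metis cst_commute mult.assoc)
  qed (simp_all add: lin_ext_add distrib_left)
qed (simp_all add: lin_ext_add distrib_right)

lemma lin_ext_fun_add: "lin_ext (\<lambda>w. f w + g w) p = lin_ext f p + lin_ext g p"
  by (simp add: lin_ext_def distrib_left sum.distrib)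

lemma lin_ext_fun_mult: "lin_ext (\<lambda>w. a * f w) p = a * lin_ext f p"
  unfolding lin_ext_def sum_distrib_left
  by (rule sum.cong) (simp_all add: mult_cst_left)

lemma word_append: "word (v @ w) = word v * word w"
  by (simp add: word_def)

lemma of_coord_simps [simp]:
  "of_coord 0 = 0"
  "of_coord (p + r) = of_coord p + of_coord r"
  "of_coord (cst c * p) = cst c * of_coord p"
  "of_coord (p * r) = of_coord p * of_coord r"
  "of_coord (Poly_Mapping.single w c) = cst c * word w"
  by (simp_all add: of_coord_def lin_ext_add lin_ext_scale lin_ext_mult word_append)

text \<open>Injectivity: the endomorphism of \<open>\<HH>\<close> with \<open>\<rho> \<mapsto> y - \<rho>\<close> turns \<open>\<xi>\<close> and \<open>z\<^sub>k\<close> into the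
  monomials \<open>\<rho>\<close> and \<open>x\<^bsup>k-1\<^esup>y\<close>, which form a prefix code.\<close>

fun subst_gen :: "gen \<Rightarrow> alg" where
  "subst_gen X = xx"
| "subst_gen Y = yy"
| "subst_gen Rho = yy - rho"

definition subst :: "alg \<Rightarrow> alg" where
  "subst = lin_ext (\<lambda>w. prod_list (map subst_gen w))"

fun code :: "letter \<Rightarrow> gen list" where
  "code Xi = [Rho]"
| "code (Zs j) = replicate j X @ [Y]"

lemma subst_add: "subst (p + r) = subst p + subst r"
  by (simp add: subst_def lin_ext_add)

lemma subst_mult: "subst (p * r) = subst p * subst r"
  by (simp add: subst_def lin_ext_mult)

lemma subst_cst: "subst (cst c) = cst c"
  by (simp add: subst_def cst_def[of c])

lemma subst_diff: "subst (p - r) = subst p - subst r"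
  by (metis add_diff_cancel diff_add_cancel subst_add)

lemma xx_pow: "xx ^ j = Poly_Mapping.single (replicate j X) 1"
proof (induction j)
  case 0
  show ?case by (metis cst_def cst_one power_0 replicate_0)
qed (simp add: xx_def single_mult_list)

lemma z_eq: "z (Suc j) = Poly_Mapping.single (replicate j X @ [Y]) 1"
  by (simp add: z_def xx_pow yy_def single_mult_list)

lemma subst_gens: "subst xx = xx" "subst yy = yy" "subst rho = yy - rho"
  by (simp_all add: subst_def xx_def yy_def rho_def)

lemma subst_pow: "subst (p ^ j) = subst p ^ j"
  by (induction j) (simp_all add: subst_mult flip: cst_one add: subst_cst)

lemma subst_elt: "subst (elt u) = Poly_Mapping.single (code u) 1"
proof (cases u)
  case Xi
  then show ?thesis by (simp add: xi_def subst_diff subst_gens) (simp add: rho_def)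
next
  case (Zs j)
  have "subst (z (Suc j)) = z (Suc j)"
    by (simp add: z_def subst_mult subst_pow subst_gens)
  then show ?thesis using Zs by (simp add: z_eq)
qed

lemma subst_word: "subst (word us) = Poly_Mapping.single (concat (map code us)) 1"
proof (induction us)
  case Nil
  show ?case by (simp add: word_def) (metis cst_def cst_one subst_cst)
next
  case (Cons u us)
  then show ?case by (simp add: word_def subst_mult subst_elt single_mult_list)
qed

lemma replicate_code_eq:
  "replicate i X @ Y # v = replicate j X @ Y # w \<Longrightarrow> i = j \<and> v = w"
proof (induction i arbitrary: j)
  case 0
  then show ?case by (cases j) auto
next
  case (Suc i)
  then show ?case by (cases j) auto
qed

lemma code_prefix: "code u @ v = code u' @ w \<Longrightarrow> u = u' \<and> v = w"
proof (cases u; cases u')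
  fix j assume "code u @ v = code u' @ w" "u = Xi" "u' = Zs j"
  then show ?thesis by (cases j) auto
next
  fix j assume "code u @ v = code u' @ w" "u = Zs j" "u' = Xi"
  then show ?thesis by (cases j) auto
qed (auto dest: replicate_code_eq)

lemma code_nonempty [simp]: "code u \<noteq> []"
  by (cases u) auto

lemma inj_code: "inj (\<lambda>us. concat (map code us))"
proof (rule injI)
  fix us vs assume "concat (map code us) = concat (map code vs)"
  then show "us = vs"
  proof (induction us arbitrary: vs)
    case Nil
    then show ?case by (cases vs) auto
  next
    case (Cons u us)
    then show ?case by (cases vs) (auto dest!: code_prefix)
  qed
qed

lemma subst_of_coord:
  "Poly_Mapping.lookup (subst (of_coord p)) (concat (map code us)) = Poly_Mapping.lookup p us"
proof (induction p rule: free_alg_induct)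
  case zero
  show ?case by (simp add: subst_def)
next
  case (single w c)
  show ?case
    using inj_eq[OF inj_code, of w us]
    by (simp add: subst_mult subst_cst subst_word lookup_single when_def)
next
  case (add p r)
  then show ?case by (simp add: subst_add lookup_add)
qed

lemma inj_of_coord: "inj of_coord"
  by (rule injI) (metis subst_of_coord poly_mapping_eqI)

lemma elt_in_AA: "elt u \<in> AA"
  by (cases u) (auto simp: AA_def)

lemma AA_eq: "AA = range elt"
proof
  show "AA \<subseteq> range elt"
  proof
    fix a assume "a \<in> AA"
    then consider "a = xi" | k where "k \<ge> 1" "a = z k" by (auto simp: AA_def)
    then show "a \<in> range elt"
    proof cases
      case 1
      then show ?thesis by (metis elt.simps(1) rangeI)
    next
      case (2 k)
      then have "a = elt (Zs (k - 1))" by simp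
      then show ?thesis by blast
    qed
  qed
qed (auto intro: elt_in_AA)

lemma word_in_H1: "word us \<in> H1"
proof (induction us)
  case Nil
  show ?case using subalg.cst[of 1 AA] by (simp add: word_def H1_def)
next
  case (Cons u us)
  then show ?case
    by (simp add: word_def H1_def) (metis elt_in_AA subalg.gen subalg.mult)
qed

lemma range_of_coord: "range of_coord = H1"
proof
  have "of_coord p \<in> H1" for p
  proof (induction p rule: free_alg_induct)
    case zero
    show ?case using subalg.cst[of 0 AA] by (simp add: H1_def)
  next
    case (single w c)
    show ?case using word_in_H1[of w] by (auto simp: H1_def intro: subalg.intros)
  next
    case (add p r)
    then show ?case by (auto simp: H1_def intro: subalg.intros)
  qed
  then show "range of_coord \<subseteq> H1" by blast
next
  have "a \<in> range of_coord" if "a \<in> subalg AA" for a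
    using that
  proof induction
    case (cst c)
    have "cst c = of_coord (Poly_Mapping.single [] c)" by (simp add: word_def)
    then show ?case by blast
  next
    case (gen a)
    then obtain u where "a = elt u" by (auto simp: AA_eq)
    then have "a = of_coord (Poly_Mapping.single [u] 1)" by (simp add: word_def)
    then show ?case by blast
  next
    case (add a b)
    then obtain p r where "a = of_coord p" "b = of_coord r" by blast
    then have "a + b = of_coord (p + r)" by simp
    then show ?case by blast
  next
    case (mult a b)
    then obtain p r where "a = of_coord p" "b = of_coord r" by blast
    then have "a * b = of_coord (p * r)" by simp
    then show ?case by blast
  qed
  then show "H1 \<subseteq> range of_coord" by (auto simp: H1_def)
qed

lemma coord_of_coord [simp]: "coord (of_coord p) = p"
  by (simp add: coord_def inj_of_coord)

lemma of_coord_coord: "a \<in> H1 \<Longrightarrow> of_coord (coord a) = a"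
  by (metis coord_of_coord range_of_coord rangeE)

lemma coord_word: "coord (word us) = Poly_Mapping.single us 1"
  by (metis coord_of_coord cst_one mult_1 of_coord_simps(5))

lemma coord_add: "a \<in> H1 \<Longrightarrow> b \<in> H1 \<Longrightarrow> coord (a + b) = coord a + coord b"
  by (metis coord_of_coord of_coord_coord of_coord_simps(2))

lemma coord_scale: "a \<in> H1 \<Longrightarrow> coord (cst c * a) = cst c * coord a"
  by (metis coord_of_coord of_coord_coord of_coord_simps(3))

lemma H1_induct [consumes 1, case_names word add scale]:
  assumes "a \<in> H1" and "\<And>us. P (word us)"
    and "\<And>a b. a \<in> H1 \<Longrightarrow> b \<in> H1 \<Longrightarrow> P a \<Longrightarrow> P b \<Longrightarrow> P (a + b)"
    and "\<And>c a. a \<in> H1 \<Longrightarrow> P a \<Longrightarrow> P (cst c * a)"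
  shows "P a"
proof -
  have "P (of_coord p)" for p
  proof (induction p rule: free_alg_induct)
    case zero
    show ?case using assms(4)[of "word []" 0] assms(2) word_in_H1 by simp
  next
    case (single w c)
    show ?case using assms(2,4) word_in_H1 by simp
  next
    case (add p r)
    have "of_coord p \<in> H1" "of_coord r \<in> H1" using range_of_coord by blast+
    then show ?case using add assms(3) by simp
  qed
  then show ?thesis using assms(1) of_coord_coord by metis
qed

text \<open>The defining properties of the harmonic product.\<close>

lemma harm_add_left: "a \<in> H1 \<Longrightarrow> b \<in> H1 \<Longrightarrow> (a + b) \<star> w = a \<star> w + b \<star> w"
  by (simp add: harm_def coord_add lin_ext_add)

lemma harm_scale_left: "a \<in> H1 \<Longrightarrow> (cst c * a) \<star> w = cst c * (a \<star> w)"
  by (simp add: harm_def coord_scale lin_ext_scale)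

lemma harm_add_right: "a \<in> H1 \<Longrightarrow> b \<in> H1 \<Longrightarrow> w \<star> (a + b) = w \<star> a + w \<star> b"
  by (simp add: harm_def coord_add lin_ext_add lin_ext_fun_add)

lemma harm_scale_right: "a \<in> H1 \<Longrightarrow> w \<star> (cst c * a) = cst c * (w \<star> a)"
  by (simp add: harm_def coord_scale lin_ext_scale lin_ext_fun_mult)

lemma harm_words: "word v \<star> word w = harm_word v w"
  by (simp add: harm_def coord_word)

lemma harm_word_Nil_right: "harm_word w [] = word w"
  by (cases w) simp_all

lemma harm_one_left: "w \<in> H1 \<Longrightarrow> 1 \<star> w = w"
proof (induction w rule: H1_induct)
  case (word us)
  show ?case using harm_words[of "[]" us] by (simp add: word_def)
qed (simp_all add: harm_add_right harm_scale_right)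

lemma harm_one_right: "w \<in> H1 \<Longrightarrow> w \<star> 1 = w"
proof (induction w rule: H1_induct)
  case (word us)
  show ?case using harm_words[of us "[]"] by (simp add: word_def harm_word_Nil_right)
qed (simp_all add: harm_add_left harm_scale_left)

lemma elt_mult_in_H1: "a \<in> H1 \<Longrightarrow> elt u * a \<in> H1"
  by (simp add: H1_def elt_in_AA subalg.gen subalg.mult)

lemma harm_rec:
  assumes "w \<in> H1" "w' \<in> H1"
  shows "(elt u * w) \<star> (elt v * w') =
    elt u * (w \<star> (elt v * w')) + elt v * ((elt u * w) \<star> w') + circ u v * (w \<star> w')"
  using assms(1)
proof (induction w rule: H1_induct)
  case (word us)
  show ?case using assms(2)
  proof (induction w' rule: H1_induct)
    case (word vs)
    show ?case
      using harm_words[of "u # us" "v # vs"] harm_words[of "us" "v # vs"]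
        harm_words[of "u # us" vs] harm_words[of us vs]
      by (simp add: word_def)
  next
    case (add a b)
    then show ?case by (simp add: harm_add_right elt_mult_in_H1 distrib_left)
  next
    case (scale c a)
    then show ?case
      by (simp add: harm_scale_right elt_mult_in_H1 distrib_left mult_cst_left)
  qed
next
  case (add a b)
  then show ?case by (simp add: harm_add_left elt_mult_in_H1 distrib_left)
next
  case (scale c a)
  then show ?case
    by (simp add: harm_scale_left elt_mult_in_H1 distrib_left mult_cst_left)
qed

text \<open>The defining properties of \<open>Z\<^sub>q\<close>.\<close>

lemma scal_simps:
  "scal q 0 = 0" "scal q 1 = 1" "scal q hbar = 1 - q"
  "scal q (a + b) = scal q a + scal q b" "scal q (a * b) = scal q a * scal q b"
proof -
  have add: "map_poly of_rat (a + b) = (map_poly of_rat a + map_poly of_rat b :: complex poly)" for a b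
    by (rule poly_eqI) (simp add: coeff_map_poly of_rat_add)
  have mult: "map_poly of_rat (a * b) = (map_poly of_rat a * map_poly of_rat b :: complex poly)" for a b
    by (rule poly_eqI) (simp add: coeff_map_poly coeff_mult of_rat_sum of_rat_mult)
  show "scal q 0 = 0" "scal q 1 = 1" "scal q hbar = 1 - q"
    by (simp_all add: scal_def hbar_def map_poly_pCons)
  show "scal q (a + b) = scal q a + scal q b" "scal q (a * b) = scal q a * scal q b"
    by (simp_all add: scal_def add mult)
qed

lemma Zq_superset:
  assumes "finite K" "Poly_Mapping.keys (coord a) \<subseteq> K"
  shows "Zq q a = (\<Sum>us\<in>K. scal q (Poly_Mapping.lookup (coord a) us) * Zq_word q us)"
  unfolding Zq_def
  by (rule sum.mono_neutral_left) (use assms in \<open>auto simp: in_keys_iff scal_simps\<close>)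

lemma Zq_add:
  assumes "a \<in> H1" "b \<in> H1"
  shows "Zq q (a + b) = Zq q a + Zq q b"
proof -
  let ?K = "Poly_Mapping.keys (coord a) \<union> Poly_Mapping.keys (coord b)"
  have "Poly_Mapping.keys (coord (a + b)) \<subseteq> ?K"
    using assms by (simp add: coord_add Poly_Mapping.keys_add)
  then show ?thesis
    using assms by (simp add: Zq_superset[of ?K] coord_add lookup_add scal_simps
        distrib_right sum.distrib)
qed

lemma Zq_scale:
  assumes "a \<in> H1"
  shows "Zq q (cst c * a) = scal q c * Zq q a"
proof -
  have "Poly_Mapping.keys (coord (cst c * a)) \<subseteq> Poly_Mapping.keys (coord a)"
    using assms by (auto simp: coord_scale in_keys_iff)
  then show ?thesis
    using assms by (simp add: Zq_superset[of "Poly_Mapping.keys (coord a)"] coord_scale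
        scal_simps sum_distrib_left mult.assoc)
qed

lemma Zq_of_word: "Zq q (word us) = Zq_word q us"
  by (simp add: Zq_def coord_word scal_simps)

lemma Zq_one: "Zq q 1 = 1"
proof -
  have "decr_seqs 0 = {[]}" by (auto simp: decr_seqs_def)
  then have "Zq_word q [] = 1" by (simp add: Zq_word_def)
  then show ?thesis using Zq_of_word[of q "[]"] by (simp add: word_def)
qed

end

theory Submission
  imports Defs
begin

text \<open>Truncate the sums to \<open>N \<ge> n\<^sub>1 > \<dots> > n\<^sub>r > 0\<close>. The truncated sums make sense on all of
  \<open>H1\<close>, and they are multiplicative for \<open>\<star>\<close>: going from \<open>N\<close> to \<open>N + 1\<close> splits off the largest
  summation index, which reproduces the recursion of \<open>\<star>\<close> because
  \<open>I\<^sub>u(n) I\<^sub>v(n) = I\<^bsub>u \<circ> v\<^esub>(n)\<close>. On \<open>Hhat0\<close>, which is closed under \<open>\<star>\<close>, the factor \<open>q\<^bsup>n\<^sub>1\<^esup>\<close>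
  beats the polynomial growth in \<open>n\<^sub>1\<close> of the inner sums, so the truncations converge to \<open>Z\<^sub>q\<close>.\<close>

section \<open>Truncated sums\<close>

text \<open>Recursion on \<open>N\<close> so that induction on \<open>N\<close> peels off the
  largest index: it is either at most \<open>N\<close> or equal to \<open>Suc N\<close>. The value
  type is general because the same sums are formed with complex terms and with their norms.\<close>

fun trunc_sum :: "('l \<Rightarrow> nat \<Rightarrow> 'a::comm_semiring_1) \<Rightarrow> nat \<Rightarrow> 'l list \<Rightarrow> 'a" where
  "trunc_sum f N [] = 1"
| "trunc_sum f 0 (u # us) = 0"
| "trunc_sum f (Suc N) (u # us) = trunc_sum f N (u # us) + f u (Suc N) * trunc_sum f N us"

section \<open>Index sequences bounded by \<open>N\<close>\<close>

definition decr_seqs_upto :: "nat \<Rightarrow> nat \<Rightarrow> nat list set" where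
  "decr_seqs_upto N r = {ns \<in> decr_seqs r. \<forall>n\<in>set ns. n \<le> N}"

lemma decr_seqs_upto_Nil: "decr_seqs_upto N 0 = {[]}"
  by (auto simp: decr_seqs_upto_def decr_seqs_def)

lemma decr_seqs_upto_zero: "decr_seqs_upto 0 (Suc r) = {}"
  by (auto simp: decr_seqs_upto_def decr_seqs_def length_Suc_conv)

lemma decr_seqs_upto_Suc:
  "decr_seqs_upto (Suc N) (Suc r) =
    decr_seqs_upto N (Suc r) \<union> (#) (Suc N) ` decr_seqs_upto N r" (is "?L = ?R")
proof
  show "?L \<subseteq> ?R"
  proof
    fix ns assume ns: "ns \<in> ?L"
    then obtain m ms where eq: "ns = m # ms"
      by (auto simp: decr_seqs_upto_def decr_seqs_def length_Suc_conv)
    have ms: "length ms = r" "sorted_wrt (>) ms" "\<forall>n\<in>set ms. 0 < n" "\<forall>n\<in>set ms. n < m"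
      "0 < m" "m \<le> Suc N"
      using ns by (auto simp: eq decr_seqs_upto_def decr_seqs_def)
    show "ns \<in> ?R"
    proof (cases "m = Suc N")
      case True
      with ms have "ms \<in> decr_seqs_upto N r"
        by (auto simp: decr_seqs_upto_def decr_seqs_def)
      then show ?thesis using True eq by blast
    next
      case False
      with ms have "\<forall>n\<in>set ns. n \<le> N" by (auto simp: eq)
      then show ?thesis using ns by (simp add: decr_seqs_upto_def)
    qed
  qed
  show "?R \<subseteq> ?L"
    by (auto simp: decr_seqs_upto_def decr_seqs_def less_Suc_eq_le le_Suc_eq)
qed

lemma finite_decr_seqs_upto: "finite (decr_seqs_upto N r)"
proof (induction N arbitrary: r)
  case 0
  then show ?case by (cases r) (simp_all add: decr_seqs_upto_Nil decr_seqs_upto_zero)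
next
  case (Suc N)
  then show ?case by (cases r) (simp_all add: decr_seqs_upto_Nil decr_seqs_upto_Suc)
qed

text \<open>The two summands of the recursion are the sums over the sequences without and with head
  \<open>Suc N\<close>; no later entry can equal \<open>Suc N\<close>, as the sequences decrease
  strictly.\<close>

lemma trunc_sum_eq:
  "trunc_sum f N us = (\<Sum>ns\<in>decr_seqs_upto N (length us). \<Prod>i<length us. f (us ! i) (ns ! i))"
proof (induction f N us rule: trunc_sum.induct)
  case (1 f N)
  show ?case by (simp add: decr_seqs_upto_Nil)
next
  case (2 f u us)
  show ?case by (simp add: decr_seqs_upto_zero)
next
  case (3 f N u us)
  let ?g = "\<lambda>vs ns. \<Prod>i<length vs. f (vs ! i) (ns ! i)"
  have "sum (?g (u # us)) (decr_seqs_upto (Suc N) (Suc (length us))) =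
      sum (?g (u # us)) (decr_seqs_upto N (Suc (length us))) +
      sum (?g (u # us)) ((#) (Suc N) ` decr_seqs_upto N (length us))"
    unfolding decr_seqs_upto_Suc
    by (rule sum.union_disjoint) (auto simp: finite_decr_seqs_upto, auto simp: decr_seqs_upto_def)
  also have "sum (?g (u # us)) ((#) (Suc N) ` decr_seqs_upto N (length us)) =
      (\<Sum>ns\<in>decr_seqs_upto N (length us). f u (Suc N) * ?g us ns)"
    by (subst sum.reindex) (simp_all only: inj_on_def o_def list.inject length_Cons
        prod.lessThan_Suc_shift nth_Cons_0 nth_Cons_Suc, simp)
  finally show ?case
    using 3 by (simp only: trunc_sum.simps length_Cons sum_distrib_left)
qed

lemma trunc_sum_Cons_eq: "trunc_sum f N (u # us) = (\<Sum>n<N. f u (Suc n) * trunc_sum f n us)"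
  by (induction N) simp_all

lemma norm_trunc_sum_nonneg: "trunc_sum (\<lambda>u n. norm (f u n)) N us \<ge> (0::real)"
  by (simp add: trunc_sum_eq sum_nonneg prod_nonneg)

section \<open>From truncated sums to unordered infinite sums\<close>

text \<open>A finite set of sequences has only finitely many entries, so some bound \<open>N\<close>
  covers all of them. This makes the truncations a cofinal sequence among the finite subsets along
  which \<open>infsum\<close> is a limit.\<close>

lemma decr_seqs_upto_exhaust:
  "filterlim (\<lambda>N. decr_seqs_upto N r) (finite_subsets_at_top (decr_seqs r)) sequentially"
proof -
  have "\<forall>\<^sub>F N in sequentially.
      finite (decr_seqs_upto N r) \<and> F \<subseteq> decr_seqs_upto N r \<and> decr_seqs_upto N r \<subseteq> decr_seqs r"
    if F: "finite F" "F \<subseteq> decr_seqs r" for F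
  \<comment> \<open>Inserting 0 keeps \<open>Max\<close> meaningful when no sequence in
    \<open>F\<close> has an entry.\<close>
  proof (rule eventually_sequentiallyI[of "Max (insert 0 (\<Union>(set ` F)))"])
    fix N assume N: "Max (insert 0 (\<Union>(set ` F))) \<le> N"
    have "n \<le> N" if "ns \<in> F" "n \<in> set ns" for ns n
    proof -
      have "n \<le> Max (insert 0 (\<Union>(set ` F)))"
        by (rule Max_ge) (use F that in auto)
      then show ?thesis using N by simp
    qed
    then show "finite (decr_seqs_upto N r) \<and> F \<subseteq> decr_seqs_upto N r \<and> decr_seqs_upto N r \<subseteq> decr_seqs r"
      using F by (auto simp: finite_decr_seqs_upto) (auto simp: decr_seqs_upto_def)
  qed
  then show ?thesis by (simp add: filterlim_finite_subsets_at_top)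
qed

text \<open>Every finite partial sum of norms is dominated by a truncated one, so the bound
  \<open>B\<close> gives absolute summability. The limit over finite subsets is then taken along the
  truncations.\<close>

lemma trunc_sum_tendsto_infsum:
  fixes f :: "'l \<Rightarrow> nat \<Rightarrow> 'a::{comm_ring_1,real_normed_field,banach}"
  assumes bound: "\<And>N. trunc_sum (\<lambda>u n. norm (f u n)) N us \<le> B"
  shows "(\<lambda>N. trunc_sum f N us) \<longlonglongrightarrow>
    (\<Sum>\<^sub>\<infinity>ns\<in>decr_seqs (length us). \<Prod>i<length us. f (us ! i) (ns ! i))"
proof -
  let ?g = "\<lambda>ns. \<Prod>i<length us. f (us ! i) (ns ! i)"
  let ?D = "decr_seqs (length us)"
  have "(\<lambda>ns. norm (?g ns)) summable_on ?D"
  proof (rule nonneg_bdd_above_summable_on)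
    have "sum (\<lambda>ns. norm (?g ns)) F \<le> B" if F: "F \<subseteq> ?D" "finite F" for F
    proof -
      have "\<forall>\<^sub>F N in sequentially. F \<subseteq> decr_seqs_upto N (length us)"
        by (rule eventually_mono[OF decr_seqs_upto_exhaust[unfolded filterlim_finite_subsets_at_top,
              rule_format, OF conjI[OF F(2,1)]]]) blast
      then obtain N where N: "F \<subseteq> decr_seqs_upto N (length us)"
        by (auto simp: eventually_sequentially)
      have "sum (\<lambda>ns. norm (?g ns)) F \<le> sum (\<lambda>ns. norm (?g ns)) (decr_seqs_upto N (length us))"
        by (rule sum_mono2) (use N in \<open>auto simp: finite_decr_seqs_upto\<close>)
      also have "\<dots> = trunc_sum (\<lambda>u n. norm (f u n)) N us"
        by (simp add: trunc_sum_eq flip: prod_norm)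
      finally show ?thesis using bound[of N] by simp
    qed
    then show "bdd_above (sum (\<lambda>ns. norm (?g ns)) ` {F. F \<subseteq> ?D \<and> finite F})"
      by (auto intro!: bdd_aboveI)
  qed simp
  then have "?g summable_on ?D" by (rule abs_summable_summable)
  then have "(sum ?g \<longlongrightarrow> infsum ?g ?D) (finite_subsets_at_top ?D)"
    by (simp add: infsum_tendsto)
  from filterlim_compose[OF this decr_seqs_upto_exhaust] show ?thesis
    by (simp add: trunc_sum_eq)
qed

section \<open>Convergence\<close>

text \<open>Write \<open>x = s * s\<close> with \<open>s = sqrt x\<close>: by induction one factor
  \<open>s ^ n\<close> controls \<open>n ^ r\<close>, and the other controls the remaining
  \<open>n\<close>.\<close>

lemma power_times_geometric_bounded:
  fixes x :: real
  assumes "0 \<le> x" "x < 1"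
  shows "\<exists>B. \<forall>n. real n ^ r * x ^ n \<le> B"
  using assms
proof (induction r arbitrary: x)
  case 0
  then show ?case by (intro exI[of _ 1]) (simp add: power_le_one)
next
  case (Suc r)
  define s where "s = sqrt x"
  have s: "0 \<le> s" "s < 1" "x = s * s" using Suc.prems by (simp_all add: s_def)
  obtain B where B: "\<And>n. real n ^ r * s ^ n \<le> B" using Suc.IH[OF s(1,2)] by blast
  have "(\<lambda>n. real n * s ^ n) \<longlonglongrightarrow> 0" using powser_times_n_limit_0[of s] s by simp
  then have "Bseq (\<lambda>n. real n * s ^ n)" using convergent_def convergent_imp_Bseq by blast
  then obtain C where C: "\<And>n. norm (real n * s ^ n) \<le> C" unfolding Bseq_def by blast
  have "real n ^ Suc r * x ^ n \<le> B * C" for n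
  proof -
    have "real n ^ Suc r * x ^ n = (real n ^ r * s ^ n) * (real n * s ^ n)"
      by (simp add: s(3) power_mult_distrib)
    also have "\<dots> \<le> B * C"
    proof (rule mult_mono)
      show "0 \<le> B" using B[of n] s(1) by (meson mult_nonneg_nonneg of_nat_0_le_iff order_trans zero_le_power)
      show "real n * s ^ n \<le> C" using C[of n] by simp
    qed (use B s(1) in simp_all)
    finally show ?thesis .
  qed
  then show ?case by blast
qed

text \<open>Again \<open>x = s * s\<close>: one factor \<open>s ^ n\<close> absorbs the polynomial,
  the other leaves a geometric majorant.\<close>

lemma summable_power_times_geometric:
  fixes x :: real
  assumes "0 \<le> x" "x < 1"
  shows "summable (\<lambda>n. real n ^ r * x ^ n)"
proof -
  define s where "s = sqrt x"
  have s: "0 \<le> s" "s < 1" "x = s * s" using assms by (simp_all add: s_def)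
  obtain B where B: "\<And>n. real n ^ r * s ^ n \<le> B" using power_times_geometric_bounded[OF s(1,2)] by blast
  show ?thesis
  proof (rule summable_comparison_test')
    show "summable (\<lambda>n. B * s ^ n)" using s by (intro summable_mult summable_geometric) simp
    show "norm (real n ^ r * x ^ n) \<le> B * s ^ n" if "n \<ge> 0" for n
    proof -
      have "norm (real n ^ r * x ^ n) = (real n ^ r * s ^ n) * s ^ n"
        using s by (simp add: power_mult_distrib)
      also have "\<dots> \<le> B * s ^ n" by (rule mult_right_mono) (use B s(1) in simp_all)
      finally show ?thesis .
    qed
  qed
qed

section \<open>Estimates for the terms \<open>Iq q u n\<close>\<close>

lemma norm_inverse_qint_le:
  assumes "norm q < 1"
  shows "inverse (norm (qint q n)) \<le> norm (1 - q) / (1 - norm q)"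
proof (cases n)
  \<comment> \<open>\<open>qint q 0\<close> is 0, and so is its inverse by convention.\<close>
  case 0
  then show ?thesis using assms by (simp add: qint_def)
next
  case (Suc m)
  have "norm q ^ n \<le> norm q" using assms Suc by (simp add: mult_left_le power_le_one)
  then have "1 - norm q \<le> norm (1 - q ^ n)"
    using norm_triangle_ineq2[of 1 "q ^ n"] by (simp add: norm_power)
  then have "norm (1 - q) / norm (1 - q ^ n) \<le> norm (1 - q) / (1 - norm q)"
    using assms by (intro divide_left_mono mult_pos_pos) auto
  then show ?thesis by (simp add: qint_def norm_divide)
qed

text \<open>\<open>Zs 0\<close> stands for \<open>z 1\<close>, whose term carries no power of
  \<open>q\<close>. Every other letter carries at least \<open>q ^ n\<close>: \<open>Zs j\<close>
  has the exponent \<open>j * n\<close> with \<open>j\<close> positive.\<close>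

lemma norm_Iq_le:
  assumes "norm q < 1"
  obtains C where "\<And>n. norm (Iq q u n) \<le> C"
    and "\<And>n. u \<noteq> Zs 0 \<Longrightarrow> norm (Iq q u n) \<le> C * norm q ^ n"
proof -
  define c where "c = norm (1 - q) / (1 - norm q)"
  have c: "inverse (norm (qint q n)) \<le> c" for n
    using norm_inverse_qint_le[OF assms] by (simp add: c_def)
  have c0: "c \<ge> 0" using assms by (simp add: c_def)
  have le1: "norm q ^ k \<le> 1" for k using assms by (simp add: power_le_one)
  show ?thesis
  proof (cases u)
    case Xi
    have *: "norm (Iq q u n) \<le> c * norm q ^ n" for n
      using mult_left_mono[OF c[of n], of "norm q ^ n"]
      by (simp add: Xi norm_mult norm_inverse norm_power divide_inverse mult.commute)
    moreover have "c * norm q ^ n \<le> c" for n using le1[of n] c0 by (simp add: mult_left_le)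
    ultimately have "norm (Iq q u n) \<le> c" for n by (meson order_trans)
    then show ?thesis using * that by blast
  next
    case (Zs j)
    have *: "norm (Iq q u n) \<le> c ^ (j + 1) * norm q ^ (j * n)" for n
      using mult_left_mono[OF power_mono[OF c[of n], of "j + 1"], of "norm q ^ (j * n)"]
      by (simp add: Zs norm_mult norm_inverse norm_power divide_inverse power_inverse mult.commute
          del: power_Suc)
    moreover have "c ^ (j + 1) * norm q ^ (j * n) \<le> c ^ (j + 1)" for n
      using le1[of "j * n"] c0 by (intro mult_left_le) simp_all
    ultimately have 1: "norm (Iq q u n) \<le> c ^ (j + 1)" for n by (meson order_trans)
    have "norm (Iq q u n) \<le> c ^ (j + 1) * norm q ^ n" if "u \<noteq> Zs 0" for n
    proof -
      have "norm q ^ (j * n) \<le> norm q ^ n"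
        using assms that Zs by (intro power_decreasing) auto
      then have "c ^ (j + 1) * norm q ^ (j * n) \<le> c ^ (j + 1) * norm q ^ n"
        using c0 by (intro mult_left_mono) simp_all
      then show ?thesis using * by (meson order_trans)
    qed
    then show ?thesis using 1 that by blast
  qed
qed

text \<open>Each letter contributes a bounded term and a sum over at most \<open>N\<close> indices,
  hence one factor \<open>N\<close>. The word is arbitrary because inner letters may be
  \<open>Zs 0\<close>.\<close>

lemma norm_trunc_sum_polynomial_bound:
  assumes "norm q < 1"
  shows "\<exists>C\<ge>0. \<forall>N. trunc_sum (\<lambda>u n. norm (Iq q u n)) N us \<le> C * real N ^ length us"
proof (induction us)
  case Nil
  then show ?case by (intro exI[of _ 1]) simp
next
  case (Cons u us)
  let ?T = "trunc_sum (\<lambda>u n. norm (Iq q u n))"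
  obtain C where C: "C \<ge> 0" "\<And>N. ?T N us \<le> C * real N ^ length us" using Cons.IH by blast
  obtain D where D: "\<And>n. norm (Iq q u n) \<le> D" using norm_Iq_le[OF assms] by blast
  have D0: "D \<ge> 0" using D[of 0] norm_ge_zero order_trans by blast
  have "?T N (u # us) \<le> (D * C) * real N ^ length (u # us)" for N
  proof -
    have "?T N (u # us) \<le> (\<Sum>n<N. D * (C * real N ^ length us))"
      unfolding trunc_sum_Cons_eq
    proof (intro sum_mono mult_mono D D0 norm_trunc_sum_nonneg)
      fix n assume "n \<in> {..<N}"
      then have "C * real n ^ length us \<le> C * real N ^ length us"
        using C(1) by (intro mult_left_mono power_mono) auto
      then show "?T n us \<le> C * real N ^ length us" using C(2)[of n] by simp
    qed
    then show ?thesis by (simp add: mult_ac)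
  qed
  then show ?case using C(1) D0 by (intro exI[of _ "D * C"]) simp
qed

text \<open>The leading letter supplies geometric decay in the largest index, while the inner sums
  grow polynomially. The series of \<open>?b\<close> therefore bounds all truncations of the sum of
  norms.\<close>

lemma trunc_sum_tendsto_Zq_word:
  assumes "norm q < 1" "u \<noteq> Zs 0"
  shows "(\<lambda>N. trunc_sum (Iq q) N (u # us)) \<longlonglongrightarrow> Zq_word q (u # us)"
proof -
  let ?T = "trunc_sum (\<lambda>u n. norm (Iq q u n))"
  obtain C where C: "C \<ge> 0" "\<And>N. ?T N us \<le> C * real N ^ length us"
    using norm_trunc_sum_polynomial_bound[OF assms(1)] by blast
  obtain D where D: "\<And>n. norm (Iq q u n) \<le> D" "\<And>n. norm (Iq q u n) \<le> D * norm q ^ n"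
    by (rule norm_Iq_le[OF assms(1), of u]) (use assms(2) that in blast)
  have D0: "D \<ge> 0" using D(1)[of 0] norm_ge_zero order_trans by blast
  let ?b = "\<lambda>n. (D * C) * (real n ^ length us * norm q ^ n)"
  have summable: "summable ?b"
    using assms(1) by (intro summable_mult summable_power_times_geometric) simp_all
  have "?T N (u # us) \<le> suminf ?b" for N
  proof -
    have "?T N (u # us) \<le> (\<Sum>n<N. (D * norm q ^ n) * (C * real n ^ length us))"
      unfolding trunc_sum_Cons_eq
    proof (intro sum_mono mult_mono norm_trunc_sum_nonneg C(2))
      fix n
      \<comment> \<open>The largest index is \<open>Suc n\<close>; the extra factor
        \<open>norm q\<close> is dropped to match \<open>?b n\<close>.\<close>
      have "D * norm q ^ Suc n \<le> D * norm q ^ n"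
        using assms(1) D0 by (intro mult_left_mono power_decreasing) auto
      then show "norm (Iq q u (Suc n)) \<le> D * norm q ^ n" using D(2)[of "Suc n"] by simp
    qed (use D0 in simp)
    also have "\<dots> = (\<Sum>n<N. ?b n)" by (simp add: mult_ac)
    also have "\<dots> \<le> suminf ?b" using summable C(1) D0 by (intro sum_le_suminf) simp_all
    finally show ?thesis .
  qed
  from trunc_sum_tendsto_infsum[of "Iq q", OF this] show ?thesis by (simp add: Zq_word_def)
qed

section \<open>Linear functionals on \<open>H1\<close>\<close>

text \<open>The formula of \<open>Zq\<close> with an arbitrary function on words in place of
  \<open>Zq_word q\<close>, so that truncated sums extend to \<open>H1\<close> in the same
  way.\<close>

definition word_functional :: "complex \<Rightarrow> (letter list \<Rightarrow> complex) \<Rightarrow> alg \<Rightarrow> complex" where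
  "word_functional q \<phi> a = (\<Sum>us\<in>Poly_Mapping.keys (coord a).
      scal q (Poly_Mapping.lookup (coord a) us) * \<phi> us)"

lemma word_functional_superset:
  assumes "finite K" "Poly_Mapping.keys (coord a) \<subseteq> K"
  shows "word_functional q \<phi> a = (\<Sum>us\<in>K. scal q (Poly_Mapping.lookup (coord a) us) * \<phi> us)"
  unfolding word_functional_def
  by (rule sum.mono_neutral_left) (use assms in \<open>auto simp: in_keys_iff scal_simps\<close>)

lemma word_functional_word [simp]: "word_functional q \<phi> (word us) = \<phi> us"
  by (simp add: word_functional_def coord_word scal_simps)

lemma word_functional_add:
  assumes "a \<in> H1" "b \<in> H1"
  shows "word_functional q \<phi> (a + b) = word_functional q \<phi> a + word_functional q \<phi> b"
proof -
  let ?K = "Poly_Mapping.keys (coord a) \<union> Poly_Mapping.keys (coord b)"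
  have "Poly_Mapping.keys (coord (a + b)) \<subseteq> ?K"
    using assms by (simp add: coord_add Poly_Mapping.keys_add)
  then show ?thesis
    using assms by (simp add: word_functional_superset[of ?K] coord_add lookup_add scal_simps
        distrib_right sum.distrib)
qed

lemma word_functional_scale:
  assumes "a \<in> H1"
  shows "word_functional q \<phi> (cst c * a) = scal q c * word_functional q \<phi> a"
proof -
  have "Poly_Mapping.keys (coord (cst c * a)) \<subseteq> Poly_Mapping.keys (coord a)"
    using assms by (auto simp: coord_scale in_keys_iff)
  then show ?thesis
    using assms by (simp add: word_functional_superset[of "Poly_Mapping.keys (coord a)"] coord_scale
        scal_simps sum_distrib_left mult.assoc)
qed

lemma H1_add: "a \<in> H1 \<Longrightarrow> b \<in> H1 \<Longrightarrow> a + b \<in> H1"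
  and H1_scale: "a \<in> H1 \<Longrightarrow> cst c * a \<in> H1"
  by (simp_all add: H1_def subalg.intros)

lemma elt_mult_word: "elt u * word us = word (u # us)"
  by (simp add: word_def)

text \<open>Moves a leading letter from the argument into the function on words, where the recursion
  of \<open>trunc_sum\<close> applies.\<close>

lemma word_functional_elt_mult:
  "a \<in> H1 \<Longrightarrow> word_functional q \<phi> (elt u * a) = word_functional q (\<lambda>us. \<phi> (u # us)) a"
  by (induction a rule: H1_induct)
    (simp_all add: elt_mult_word distrib_left mult_cst_left word_functional_add
      word_functional_scale elt_mult_in_H1)

lemma word_functional_fun_lin:
  "word_functional q (\<lambda>us. \<phi> us + c * \<psi> us) a = word_functional q \<phi> a + c * word_functional q \<psi> a"
  by (simp add: word_functional_def distrib_left sum.distrib sum_distrib_left mult_ac)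

section \<open>Multiplicativity of the truncated sums\<close>

abbreviation Zq_trunc :: "complex \<Rightarrow> nat \<Rightarrow> alg \<Rightarrow> complex" where
  "Zq_trunc q N \<equiv> word_functional q (trunc_sum (Iq q) N)"

lemma Zq_trunc_elt_mult_zero: "a \<in> H1 \<Longrightarrow> Zq_trunc q 0 (elt u * a) = 0"
  by (simp add: word_functional_elt_mult) (simp add: word_functional_def)

lemma Zq_trunc_elt_mult_Suc:
  "a \<in> H1 \<Longrightarrow> Zq_trunc q (Suc N) (elt u * a) =
    Zq_trunc q N (elt u * a) + Iq q u (Suc N) * Zq_trunc q N a"
  by (simp add: word_functional_elt_mult word_functional_fun_lin)

section \<open>Compatibility of \<open>circ\<close> with products of terms\<close>

text \<open>The rules of \<open>circ\<close> with \<open>hbar\<close> acting as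
  \<open>1 - q\<close>. The correction terms come from
  \<open>q ^ n = 1 - (1 - q) * qint q n\<close>; the assumptions make \<open>qint q n\<close>
  nonzero.\<close>

lemma Iq_products:
  assumes "norm q < 1" "n > 0"
  shows "Iq q Xi n * Iq q (Zs j) n = Iq q (Zs (Suc j)) n"
    and "Iq q Xi n * Iq q Xi n = Iq q (Zs 1) n - (1 - q) * Iq q Xi n"
    and "Iq q (Zs i) n * Iq q (Zs j) n =
      Iq q (Zs (i + j + 1)) n + (1 - q) * Iq q (Zs (i + j)) n"
proof -
  define t where "t = qint q n"
  have q1: "q \<noteq> 1" using assms(1) by auto
  have "norm (q ^ n) < 1" using assms by (simp add: norm_power power_less_one_iff)
  then have "q ^ n \<noteq> 1" by auto
  then have t0: "t \<noteq> 0" using q1 by (simp add: t_def qint_def)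
  have qn: "q ^ n = 1 - (1 - q) * t" using q1 by (simp add: t_def qint_def)
  show "Iq q Xi n * Iq q (Zs j) n = Iq q (Zs (Suc j)) n"
    by (simp add: power_add)
  show "Iq q Xi n * Iq q Xi n = Iq q (Zs 1) n - (1 - q) * Iq q Xi n"
    using t0 by (simp flip: t_def add: qn divide_simps) algebra
  have "Iq q (Zs i) n * Iq q (Zs j) n = q ^ (i * n) * q ^ (j * n) / t ^ (i + j + 2)"
    by (simp flip: t_def add: power_add power2_eq_square)
  \<comment> \<open>Insert the factor \<open>1 = q ^ n + (1 - q) * t\<close>.\<close>
  also have "\<dots> = q ^ (i * n) * q ^ (j * n) * (q ^ n + (1 - q) * t) / t ^ (i + j + 2)"
    by (simp add: qn)
  also have "\<dots> = q ^ ((i + j + 1) * n) / t ^ (i + j + 2) + (1 - q) * (q ^ ((i + j) * n) / t ^ (i + j + 1))"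
    using t0 by (simp add: divide_simps power_add algebra_simps power2_eq_square)
  finally show "Iq q (Zs i) n * Iq q (Zs j) n =
      Iq q (Zs (i + j + 1)) n + (1 - q) * Iq q (Zs (i + j)) n"
    by (simp add: t_def)
qed

lemma scal_minus_hbar: "scal q (- hbar) = - (1 - q)"
  using scal_simps(4)[of q hbar "- hbar"] by (simp add: scal_simps(1,3) algebra_simps add_eq_0_iff)

text \<open>One shape for all cases of \<open>circ\<close>, collecting what is used later: letters
  other than \<open>Zs 0\<close> produce only such letters, and \<open>circ\<close> matches the
  product of terms.\<close>

lemma circ_as_letters:
  obtains s c t where "circ u v = elt s + cst c * elt t"
    and "u \<noteq> Zs 0 \<Longrightarrow> v \<noteq> Zs 0 \<Longrightarrow> s \<noteq> Zs 0 \<and> t \<noteq> Zs 0"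
    and "\<And>q n. norm q < 1 \<Longrightarrow> n > 0 \<Longrightarrow>
      Iq q u n * Iq q v n = Iq q s n + scal q c * Iq q t n"
proof (cases u)
  case u: Xi
  show ?thesis
  proof (cases v)
    case Xi
    have "cst (- hbar) = - (cst hbar :: alg)"
      using cst_add[of hbar "- hbar"] by (simp add: eq_neg_iff_add_eq_0 add.commute)
    then have "circ u v = elt (Zs 1) + cst (- hbar) * elt Xi"
      by (simp add: u Xi numeral_2_eq_2)
    then show ?thesis
      by (rule that) (simp_all add: u Xi Iq_products(2) scal_minus_hbar algebra_simps
          del: Iq.simps)
  next
    case (Zs j)
    \<comment> \<open>There is a single letter here: the second has coefficient 0 and repeats the
      first, so that it is not \<open>Zs 0\<close>.\<close>
    show ?thesis
      by (rule that[of "Zs (Suc j)" 0 "Zs (Suc j)"])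
        (simp_all add: u Zs Iq_products(1) scal_simps del: Iq.simps)
  qed
next
  case u: (Zs i)
  show ?thesis
  proof (cases v)
    case Xi
    show ?thesis
      by (rule that[of "Zs (Suc i)" 0 "Zs (Suc i)"])
        (simp_all add: u Xi Iq_products(1) scal_simps mult.commute[of "Iq _ (Zs i) _"] del: Iq.simps)
  next
    case (Zs j)
    show ?thesis
      by (rule that[of "Zs (i + j + 1)" hbar "Zs (i + j)"])
        (simp_all add: u Zs Iq_products(3) scal_simps del: Iq.simps)
  qed
qed

lemma circ_mult_in_H1: "a \<in> H1 \<Longrightarrow> circ u v * a \<in> H1"
  by (rule circ_as_letters[of u v])
    (simp add: distrib_right mult.assoc H1_add H1_scale elt_mult_in_H1)

lemma Zq_trunc_circ_mult_zero:
  assumes "a \<in> H1"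
  shows "Zq_trunc q 0 (circ u v * a) = 0"
  using assms by (rule_tac circ_as_letters[of u v])
    (simp add: distrib_right mult.assoc H1_scale elt_mult_in_H1 word_functional_add
      word_functional_scale Zq_trunc_elt_mult_zero)

lemma Zq_trunc_circ_mult_Suc:
  assumes "norm q < 1" "a \<in> H1"
  shows "Zq_trunc q (Suc N) (circ u v * a) =
    Zq_trunc q N (circ u v * a) + Iq q u (Suc N) * Iq q v (Suc N) * Zq_trunc q N a"
proof -
  obtain s c t where eq: "circ u v = elt s + cst c * elt t"
    and prod: "Iq q u (Suc N) * Iq q v (Suc N) = Iq q s (Suc N) + scal q c * Iq q t (Suc N)"
    using circ_as_letters[of u v] assms(1) zero_less_Suc by metis
  show ?thesis
    unfolding prod eq using assms(2)
    by (simp add: distrib_right distrib_left mult.assoc H1_scale elt_mult_in_H1 word_functional_add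
        word_functional_scale Zq_trunc_elt_mult_Suc del: Iq.simps)
qed

lemma harm_word_in_H1: "harm_word v w \<in> H1"
proof (induction v w rule: harm_word.induct)
  case (3 u w v w')
  then show ?case by (simp add: H1_add elt_mult_in_H1 circ_mult_in_H1)
qed (simp_all add: word_in_H1 del: harm_word.simps(3))

lemma harm_in_H1: "a \<in> H1 \<Longrightarrow> b \<in> H1 \<Longrightarrow> a \<star> b \<in> H1"
proof (induction a rule: H1_induct)
  case (word us)
  from word show ?case
    by (induction b rule: H1_induct)
      (simp_all add: harm_words harm_word_in_H1 harm_add_right harm_scale_right H1_add H1_scale)
qed (simp_all add: harm_add_left harm_scale_left H1_add H1_scale)

text \<open>Splitting off the index \<open>Suc N\<close> on both sides gives four products,
  according to which of the two words uses it. The words are arbitrary in the induction since all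
  four pairs of words and tails occur.\<close>

lemma Zq_trunc_harm_word:
  assumes "norm q < 1"
  shows "Zq_trunc q N (harm_word v w) = trunc_sum (Iq q) N v * trunc_sum (Iq q) N w"
proof (induction N arbitrary: v w)
  \<comment> \<open>For two nonempty words both sides vanish, since each summand of
    \<open>harm_word\<close> starts with a letter.\<close>
  case 0
  show ?case
    by (induction v w rule: harm_word.induct)
      (simp_all add: word_functional_add H1_add elt_mult_in_H1 circ_mult_in_H1 harm_word_in_H1
        Zq_trunc_elt_mult_zero Zq_trunc_circ_mult_zero)
next
  case (Suc N)
  show ?case
  proof (cases "v = [] \<or> w = []")
    case True
    then show ?thesis by (auto simp: harm_word_Nil_right)
  next
    case False
    then obtain u v' u' w' where [simp]: "v = u # v'" "w = u' # w'"
      by (meson neq_Nil_conv)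
    \<comment> \<open>The hypothesis for the full words, expanded by \<open>harm_word\<close>,
      accounts for the part where neither word uses \<open>Suc N\<close>.\<close>
    have IH: "Zq_trunc q N (elt u * harm_word v' w) + Zq_trunc q N (elt u' * harm_word v w')
        + Zq_trunc q N (circ u u' * harm_word v' w')
        = trunc_sum (Iq q) N v * trunc_sum (Iq q) N w"
      using Suc[of v w]
      by (simp add: word_functional_add H1_add elt_mult_in_H1 circ_mult_in_H1 harm_word_in_H1)
    have "Zq_trunc q (Suc N) (harm_word v w) =
        (Zq_trunc q N (elt u * harm_word v' w) + Zq_trunc q N (elt u' * harm_word v w')
          + Zq_trunc q N (circ u u' * harm_word v' w'))
        + Iq q u (Suc N) * Zq_trunc q N (harm_word v' w)
        + Iq q u' (Suc N) * Zq_trunc q N (harm_word v w')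
        + Iq q u (Suc N) * Iq q u' (Suc N) * Zq_trunc q N (harm_word v' w')"
      by (simp add: word_functional_add H1_add elt_mult_in_H1 circ_mult_in_H1 harm_word_in_H1
          Zq_trunc_elt_mult_Suc Zq_trunc_circ_mult_Suc[OF assms] del: Iq.simps)
    then show ?thesis
      unfolding IH Suc by (simp add: algebra_simps del: Iq.simps)
  qed
qed

lemma Zq_trunc_harm:
  assumes "norm q < 1" "a \<in> H1" "b \<in> H1"
  shows "Zq_trunc q N (a \<star> b) = Zq_trunc q N a * Zq_trunc q N b"
  using assms(2)
proof (induction a rule: H1_induct)
  case (word us)
  show ?case using assms(3)
    by (induction b rule: H1_induct)
      (simp_all add: harm_words Zq_trunc_harm_word[OF assms(1)] harm_add_right harm_scale_right
        word_functional_add word_functional_scale harm_in_H1 word_in_H1 distrib_left)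
qed (simp_all add: harm_add_left harm_scale_left word_functional_add word_functional_scale
    harm_in_H1 assms(3) distrib_right)

section \<open>The limit on \<open>Hhat0\<close>\<close>

text \<open>A presentation of the admissible elements suited to induction: it contains
  \<open>Hhat0\<close>, and closure under sums and scalars is built in.\<close>

inductive_set adm :: "alg set" where
  one: "1 \<in> adm"
| elt_mult: "u \<noteq> Zs 0 \<Longrightarrow> a \<in> H1 \<Longrightarrow> elt u * a \<in> adm"
| add: "a \<in> adm \<Longrightarrow> b \<in> adm \<Longrightarrow> a + b \<in> adm"
| scale: "a \<in> adm \<Longrightarrow> cst c * a \<in> adm"

lemma one_in_H1: "1 \<in> H1"
  using word_in_H1[of "[]"] by (simp add: word_def)

lemma adm_in_H1: "a \<in> adm \<Longrightarrow> a \<in> H1"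
  by (induction rule: adm.induct) (simp_all add: one_in_H1 elt_mult_in_H1 H1_add H1_scale)

lemma zero_in_adm: "0 \<in> adm"
  using adm.scale[OF adm.one, of 0] by simp

lemma Hhat0_subset_adm: "Hhat0 \<subseteq> adm"
proof
  fix w assume "w \<in> Hhat0"
  then obtain c a b m where w: "w = cst c + xi * a + (\<Sum>k=2..m. z k * b k)"
    and a: "a \<in> H1" and b: "\<And>k. b k \<in> H1"
    unfolding Hhat0_def by blast
  have "cst c \<in> adm" using adm.scale[OF adm.one, of c] by simp
  moreover have "xi * a \<in> adm" using adm.elt_mult[of Xi a] a by simp
  \<comment> \<open>\<open>z k\<close> is named \<open>Zs (k - 1)\<close>, which differs from
    \<open>Zs 0\<close> because \<open>k\<close> is at least 2.\<close>
  moreover have zb: "z k * b k \<in> adm" if "k \<ge> 2" for k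
    using adm.elt_mult[of "Zs (k - 1)" "b k"] b that by simp
  have "(\<Sum>k\<in>K. z k * b k) \<in> adm" if "finite K" "\<forall>k\<in>K. k \<ge> 2" for K
    using that by (induction K) (auto intro: zero_in_adm adm.add zb)
  then have "(\<Sum>k=2..m. z k * b k) \<in> adm" by simp
  ultimately show "w \<in> adm" unfolding w by (intro adm.add)
qed

lemma circ_mult_in_adm:
  assumes "u \<noteq> Zs 0" "v \<noteq> Zs 0" "a \<in> H1"
  shows "circ u v * a \<in> adm"
proof -
  obtain s c t where "circ u v = elt s + cst c * elt t" "s \<noteq> Zs 0" "t \<noteq> Zs 0"
    using circ_as_letters[of u v] assms(1,2) by metis
  then show ?thesis
    using assms(3) by (simp add: distrib_right mult.assoc adm.intros)
qed

text \<open>In \<open>harm_rec\<close> each summand begins with \<open>u\<close>, \<open>v\<close>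
  or a letter of \<open>circ u v\<close>, none of them \<open>Zs 0\<close>; what follows that letter
  only has to lie in \<open>H1\<close>.\<close>

lemma harm_in_adm: "a \<in> adm \<Longrightarrow> b \<in> adm \<Longrightarrow> a \<star> b \<in> adm"
proof (induction a rule: adm.induct)
  case one
  then show ?case by (simp add: harm_one_left adm_in_H1)
next
  case (elt_mult u a)
  from elt_mult(3) show ?case
  proof (induction b rule: adm.induct)
    case one
    then show ?case using elt_mult by (simp add: harm_one_right elt_mult_in_H1 adm.elt_mult)
  next
    case (elt_mult v b)
    then show ?case
      using \<open>u \<noteq> Zs 0\<close> \<open>a \<in> H1\<close>
      by (simp add: harm_rec adm.add adm.elt_mult harm_in_H1 elt_mult_in_H1 circ_mult_in_adm)
  qed (simp_all add: harm_add_right harm_scale_right adm_in_H1 adm.add adm.scale)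
qed (simp_all add: harm_add_left harm_scale_left adm_in_H1 adm.add adm.scale)

text \<open>Linearity of both sides reduces this to single words with an admissible first letter,
  where the truncated sums are known to converge.\<close>

lemma Zq_trunc_tendsto_Zq:
  assumes "norm q < 1" "a \<in> adm"
  shows "(\<lambda>N. Zq_trunc q N a) \<longlonglongrightarrow> Zq q a"
  using assms(2)
proof (induction rule: adm.induct)
  case one
  have "Zq_trunc q N 1 = 1" for N
    using word_functional_word[of q "trunc_sum (Iq q) N" "[]"] by (simp add: word_def)
  then show ?case by (simp add: Zq_one)
next
  case (elt_mult u a)
  from elt_mult(2) show ?case
  proof (induction a rule: H1_induct)
    case (word us)
    show ?case
      using trunc_sum_tendsto_Zq_word[OF assms(1) elt_mult(1)]
      by (simp add: elt_mult_word Zq_of_word)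
  qed (simp_all add: distrib_left mult_cst_left word_functional_add word_functional_scale
      Zq_add Zq_scale elt_mult_in_H1 tendsto_add tendsto_mult_left)
qed (simp_all add: word_functional_add word_functional_scale Zq_add Zq_scale adm_in_H1
    tendsto_add tendsto_mult_left)

theorem theorem1:
  fixes q :: complex and w w' :: alg
  assumes "0 < norm q" and "norm q < 1"
    and "w \<in> Hhat0" and "w' \<in> Hhat0"
  shows "Zq q (w \<star> w') = Zq q w * Zq q w'"
proof (rule LIMSEQ_unique)
  have w: "w \<in> adm" "w' \<in> adm" using assms Hhat0_subset_adm by auto
  show "(\<lambda>N. Zq_trunc q N (w \<star> w')) \<longlonglongrightarrow> Zq q (w \<star> w')"
    using assms(2) w by (intro Zq_trunc_tendsto_Zq harm_in_adm)
  have "(\<lambda>N. Zq_trunc q N w * Zq_trunc q N w') \<longlonglongrightarrow> Zq q w * Zq q w'"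
    using assms(2) w by (intro tendsto_mult Zq_trunc_tendsto_Zq)
  then show "(\<lambda>N. Zq_trunc q N (w \<star> w')) \<longlonglongrightarrow> Zq q w * Zq q w'"
    using assms(2) w by (simp add: Zq_trunc_harm adm_in_H1)
qed

end
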